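(* None of the following inclusions holds for every $r\in\mathbb{N}=\{0,1,2,\ldots\}$: (a) $\mathcal{R}^{r}_{ref}\subset\mathcal{R}^{r+1}_{ref}$; (b) $\mathcal{R}^{r}_{MS}\subset\mathcal{R}^{r+1}_{MS}$; (c) $\mathcal{R}^{r}_{AS}\subset\mathcal{R}^{r+1}_{AS}$. That is, for each of (a), (b), (c) there exists $r\in\mathbb{N}$ for which the inclusion fails.
   Context: For $r\in\mathbb{N}$ (with $0\in\mathbb{N}$) and $z\in\mathbb{C}$ define $f_{r,z}\colon\mathbb{R}\to\mathbb{C}$ by $f_{r,z}(t)=\sum_{j=0}^{r+1}\frac{z^j}{j!}+\frac{t^{r+1}}{(r+1)!}z^{r+2}$. Let $\tau_1,\tau_2,\ldots$ be independent random variables, uniformly distributed on $[0,1]$, on a probability space $(\Omega,\Sigma,\mathbb{P})$, and fix $\eta\neq 0$. For $z\in\mathbb{C}$ put $v^r_k=v^r_k(z)=\eta\prod_{l=1}^k f_{r,z}(\tau_l)$, $k\in\mathbb{N}$. Define $\mathcal{R}^r_{MS}=\{z\in\mathbb{C}\colon v^r_k\to0 \text{ in } L^2(\Omega) \text{ as } k\to\infty\}$ (region of mean-square stability), $\mathcal{R}^r_{AS}=\{z\in\mathbb{C}\colon v^r_k\to0 \text{ almost surely as } k\to\infty\}$ (region of asymptotic stability), $\mathcal{R}^r_{ref}=\{z\in\mathbb{C}\colon |\sum_{j=0}^{r+2}\frac{z^j}{j!}|<1\}$ (reference set). *)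

theory Defs
  imports "HOL-Probability.Probability"
begin

definition f_fun :: "nat \<Rightarrow> complex \<Rightarrow> real \<Rightarrow> complex" where
  "f_fun r z t = (\<Sum>j=0..r+1. z ^ j / fact j)
     + complex_of_real (t ^ (r+1) / fact (r+1)) * z ^ (r+2)"

definition v_seq :: "complex \<Rightarrow> (nat \<Rightarrow> 'a \<Rightarrow> real) \<Rightarrow> nat \<Rightarrow> complex \<Rightarrow> nat \<Rightarrow> 'a \<Rightarrow> complex" where
  "v_seq \<eta> \<tau> r z k \<omega> = \<eta> * (\<Prod>l=1..k. f_fun r z (\<tau> l \<omega>))"

text \<open>Membership in \<open>L\<^sup>2\<close> is required explicitly, since the Bochner integral of a
  non-integrable function is \<open>0\<close>.\<close>

definition in_L2 :: "'a measure \<Rightarrow> ('a \<Rightarrow> complex) \<Rightarrow> bool" where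
  "in_L2 M X \<longleftrightarrow> X \<in> borel_measurable M \<and> integrable M (\<lambda>\<omega>. (cmod (X \<omega>))\<^sup>2)"

definition L2_norm :: "'a measure \<Rightarrow> ('a \<Rightarrow> complex) \<Rightarrow> real" where
  "L2_norm M X = sqrt (\<integral>\<omega>. (cmod (X \<omega>))\<^sup>2 \<partial>M)"

definition R_MS :: "'a measure \<Rightarrow> (nat \<Rightarrow> 'a \<Rightarrow> real) \<Rightarrow> complex \<Rightarrow> nat \<Rightarrow> complex set" where
  "R_MS M \<tau> \<eta> r = {z. (\<forall>k. in_L2 M (v_seq \<eta> \<tau> r z k)) \<and>
                       (\<lambda>k. L2_norm M (v_seq \<eta> \<tau> r z k)) \<longlonglongrightarrow> 0}"

definition R_AS :: "'a measure \<Rightarrow> (nat \<Rightarrow> 'a \<Rightarrow> real) \<Rightarrow> complex \<Rightarrow> nat \<Rightarrow> complex set" where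
  "R_AS M \<tau> \<eta> r = {z. AE \<omega> in M. (\<lambda>k. v_seq \<eta> \<tau> r z k \<omega>) \<longlonglongrightarrow> 0}"

definition R_ref :: "nat \<Rightarrow> complex set" where
  "R_ref r = {z. cmod (\<Sum>j=0..r+2. z ^ j / fact j) < 1}"

end

theory Submission imports Defs begin

text \<open>All three inclusions fail at \<open>z = \<i>\<close> when passing from \<open>r = 2\<close> to \<open>r = 3\<close>, where
  \<open>|f\<^sub>2(t)|\<^sup>2 = ((3 + t\<^sup>3)\<^sup>2 + 25) / 36\<close> and \<open>|f\<^sub>3(t)|\<^sup>2 = (169 + (20 + t\<^sup>4)\<^sup>2) / 576\<close> with
  \<open>E |f\<^sub>2|\<^sup>2 < 1 < E |f\<^sub>3|\<^sup>2\<close>. For almost sure behaviour, the expectation of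
  a product of independent factors is geometric, so a mean below 1 makes a nonnegative product
  tend to \<open>0\<close> almost surely. This applies to \<open>|f\<^sub>2|\<^sup>2\<close>, and also to \<open>1 / |f\<^sub>3|\<^sup>2\<close>: although
  \<open>E |f\<^sub>3|\<^sup>2 > 1\<close> alone would not exclude almost sure decay, \<open>E |f\<^sub>3|\<^sup>-\<^sup>2 < 1\<close> forces
  \<open>|v\<^sub>k| \<rightarrow> \<infinity>\<close>.\<close>

section \<open>Expectations and almost sure limits of products of i.i.d. factors\<close>

lemma (in prob_space) has_bochner_integral_prod_iid:
  fixes g :: "'b \<Rightarrow> real"
  assumes "indep_vars (\<lambda>_. S) X {1..}" and "\<And>l. l \<ge> 1 \<Longrightarrow> distr M S (X l) = N"
    and g: "g \<in> borel_measurable S" and c: "has_bochner_integral N g c"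
  shows "has_bochner_integral M (\<lambda>\<omega>. \<Prod>l=1..k::nat. g (X l \<omega>)) (c ^ k)"
proof -
  have indep: "indep_vars (\<lambda>_. borel) (\<lambda>l \<omega>. g (X l \<omega>)) {1..k}"
    using assms by (intro indep_vars_compose2[OF indep_vars_subset[OF assms(1)]]) auto
  have X: "X l \<in> measurable M S" if "l \<ge> 1" for l
    using assms(1) that by (auto simp: indep_vars_def)
  have int: "integrable M (\<lambda>\<omega>. g (X l \<omega>))" if "l \<ge> 1" for l
    using c integrable_distr_eq[OF X g] assms(2) that by (simp add: has_bochner_integral_iff)
  have val: "(\<integral>\<omega>. g (X l \<omega>) \<partial>M) = c" if "l \<ge> 1" for l
    using c integral_distr[OF X g] assms(2) that by (simp add: has_bochner_integral_iff)
  show ?thesis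
    using indep_vars_lebesgue_integral[OF _ indep] indep_vars_integrable[OF _ indep] int val
    by (simp add: has_bochner_integral_iff)
qed

text \<open>By monotone convergence the expected sum of the \<open>Y k\<close> is the sum of the
  \<open>y k\<close>, hence finite. So the series converges almost everywhere, and its terms vanish
  in the limit.\<close>

lemma AE_tendsto_0_if_summable_integral:
  fixes Y :: "nat \<Rightarrow> 'a \<Rightarrow> real"
  assumes int: "\<And>k. has_bochner_integral M (Y k) (y k)" and nonneg: "\<And>k \<omega>. 0 \<le> Y k \<omega>"
    and "summable y"
  shows "AE \<omega> in M. (\<lambda>k. Y k \<omega>) \<longlonglongrightarrow> 0"
proof -
  have [measurable]: "Y k \<in> borel_measurable M" for k
    using int[of k] by (auto simp: has_bochner_integral_iff)
  have y: "0 \<le> y k" for k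
    using int[of k] integral_nonneg_AE[of "Y k" M] nonneg by (simp add: has_bochner_integral_iff)
  have "(\<integral>\<^sup>+\<omega>. (\<Sum>k. ennreal (Y k \<omega>)) \<partial>M) = (\<Sum>k. \<integral>\<^sup>+\<omega>. ennreal (Y k \<omega>) \<partial>M)"
    by (rule nn_integral_suminf) simp
  also have "\<dots> = (\<Sum>k. ennreal (y k))"
    using int nonneg by (intro suminf_cong) (simp add: nn_integral_eq_integral has_bochner_integral_iff)
  also have "\<dots> = ennreal (suminf y)"
    using y \<open>summable y\<close> by (rule suminf_ennreal2)
  finally have "AE \<omega> in M. (\<Sum>k. ennreal (Y k \<omega>)) \<noteq> \<infinity>"
    by (intro nn_integral_PInf_AE) auto
  then show ?thesis
  proof eventually_elim
    case (elim \<omega>)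
    then have "summable (\<lambda>k. Y k \<omega>)"
      using nonneg by (intro summable_suminf_not_top) auto
    then show ?case by (rule summable_LIMSEQ_zero)
  qed
qed

text \<open>The function \<open>g\<close> is kept general because it is instantiated twice: with a
  squared modulus to obtain decay, and with a reciprocal squared modulus to obtain growth.\<close>

lemma (in prob_space) AE_prod_iid_tendsto_0:
  fixes g :: "'b \<Rightarrow> real"
  assumes "indep_vars (\<lambda>_. S) X {1..}" and "\<And>l. l \<ge> 1 \<Longrightarrow> distr M S (X l) = N"
    and "g \<in> borel_measurable S" and "has_bochner_integral N g c"
    and "\<And>t. 0 \<le> g t" and "c < 1"
  shows "AE \<omega> in M. (\<lambda>k. \<Prod>l=1..k::nat. g (X l \<omega>)) \<longlonglongrightarrow> 0"
proof (rule AE_tendsto_0_if_summable_integral)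
  show "has_bochner_integral M (\<lambda>\<omega>. \<Prod>l=1..k. g (X l \<omega>)) (c ^ k)" for k
    by (rule has_bochner_integral_prod_iid[OF assms(1-4)])
  show "0 \<le> (\<Prod>l=1..k. g (X l \<omega>))" for k \<omega>
    using assms(5) by (simp add: prod_nonneg)
  have "0 \<le> c"
    using assms(4,5) by (auto simp: has_bochner_integral_iff)
  with \<open>c < 1\<close> show "summable (\<lambda>k. c ^ k)"
    by (simp add: summable_geometric)
qed

text \<open>The interval has length 1, so the uniform law is Lebesgue measure weighted by an
  indicator, and the fundamental theorem of calculus applies.\<close>

lemma has_bochner_integral_uniform_FTC:
  fixes f :: "real \<Rightarrow> real"
  assumes "\<And>x. (F has_real_derivative f x) (at x)" and "continuous_on UNIV f"
  shows "has_bochner_integral (uniform_measure lborel {0..1}) f (F 1 - F 0)"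
proof -
  have f: "f \<in> borel_measurable lborel"
    using borel_measurable_continuous_onI[OF assms(2)] by simp
  have "uniform_measure lborel {0..1::real} = density lborel (\<lambda>x. ennreal (indicator {0..1} x))"
    unfolding uniform_measure_def by (intro density_cong) (auto split: split_indicator simp: divide_ennreal_def)
  moreover have "has_bochner_integral (density lborel (\<lambda>x. ennreal (indicator {0..1} x))) f (F 1 - F 0)"
  proof (rule has_bochner_integral_density[OF f])
    show "has_bochner_integral lborel (\<lambda>x. indicator {0..1} x *\<^sub>R f x) (F 1 - F 0)"
      using has_bochner_integral_FTC_Icc_real[of 0 1 F f] assms
      by (simp add: mult.commute continuous_on_eq_continuous_at)
  qed auto
  ultimately show ?thesis by simp
qed

section \<open>Mean-square stability in terms of the second moment of one factor\<close>

lemma f_fun_measurable [measurable]: "f_fun r z \<in> borel_measurable borel"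
  unfolding f_fun_def by measurable

lemma cmod_v_seq_power2:
  "(cmod (v_seq \<eta> \<tau> r z k \<omega>))\<^sup>2 = (cmod \<eta>)\<^sup>2 * (\<Prod>l=1..k. (cmod (f_fun r z (\<tau> l \<omega>)))\<^sup>2)"
  by (simp add: v_seq_def norm_mult power_mult_distrib prod_norm[symmetric] prod_power_distrib)

text \<open>Independence makes the \<open>L2_norm\<close> of the \<open>k\<close>-th iterate exactly
  geometric with ratio \<open>sqrt c\<close>, so the mean alone decides membership, in both
  directions.\<close>

lemma R_MS_iff:
  assumes "prob_space M" and "prob_space.indep_vars M (\<lambda>_. borel) \<tau> {1..}"
    and "\<And>l. l \<ge> 1 \<Longrightarrow> distr M borel (\<tau> l) = N" and "\<eta> \<noteq> 0"
    and c: "has_bochner_integral N (\<lambda>t. (cmod (f_fun r z t))\<^sup>2) c"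
  shows "z \<in> R_MS M \<tau> \<eta> r \<longleftrightarrow> c < 1"
proof -
  interpret prob_space M by fact
  have "0 \<le> c"
    using c by (auto simp: has_bochner_integral_iff)
  have int: "has_bochner_integral M (\<lambda>\<omega>. (cmod (v_seq \<eta> \<tau> r z k \<omega>))\<^sup>2) ((cmod \<eta>)\<^sup>2 * c ^ k)" for k
    unfolding cmod_v_seq_power2
    by (intro has_bochner_integral_mult_right has_bochner_integral_prod_iid[OF assms(2,3) _ c]) auto
  have \<tau>: "\<tau> l \<in> borel_measurable M" if "l \<ge> 1" for l
    using assms(2) that by (auto simp: indep_vars_def)
  have "v_seq \<eta> \<tau> r z k \<in> borel_measurable M" for k
    unfolding v_seq_def[abs_def]
    by (intro borel_measurable_times borel_measurable_const borel_measurable_prod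
        measurable_compose[OF \<tau> f_fun_measurable]) auto
  then have L2: "in_L2 M (v_seq \<eta> \<tau> r z k)" for k
    using int[of k] by (simp add: in_L2_def has_bochner_integral_iff)
  have norm: "L2_norm M (v_seq \<eta> \<tau> r z k) = cmod \<eta> * sqrt c ^ k" for k
    using int[of k] by (simp add: L2_norm_def has_bochner_integral_iff real_sqrt_mult real_sqrt_power)
  have "(\<lambda>k. cmod \<eta> * sqrt c ^ k) \<longlonglongrightarrow> 0 \<longleftrightarrow> (\<lambda>k. sqrt c ^ k) \<longlonglongrightarrow> 0"
    using \<open>\<eta> \<noteq> 0\<close> tendsto_mult_left_iff[of "cmod \<eta>" "\<lambda>k. sqrt c ^ k" 0 sequentially] by simp
  also have "\<dots> \<longleftrightarrow> c < 1"
  proof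
    assume lim: "(\<lambda>k. sqrt c ^ k) \<longlonglongrightarrow> 0"
    show "c < 1"
    proof (rule ccontr)
      assume "\<not> c < 1"
      then have "1 \<le> sqrt c ^ k" for k
        by (intro one_le_power) simp
      then show False
        using LIMSEQ_le_const[OF lim, of 1] by auto
    qed
  qed (use \<open>0 \<le> c\<close> in \<open>auto intro: LIMSEQ_power_zero\<close>)
  finally show ?thesis
    by (simp add: R_MS_def L2 norm)
qed

section \<open>Explicit factors and their moments at \<open>z = \<i>\<close>\<close>

lemma f_fun_2_ii: "f_fun 2 \<i> t = Complex ((3 + t ^ 3) / 6) (5 / 6)"
  by (simp add: f_fun_def complex_eq_iff numeral_eq_Suc fact_numeral field_simps)

lemma f_fun_3_ii: "f_fun 3 \<i> t = Complex (13 / 24) ((20 + t ^ 4) / 24)"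
  by (simp add: f_fun_def complex_eq_iff numeral_eq_Suc fact_numeral field_simps)

lemma cmod_f_fun_2_ii: "(cmod (f_fun 2 \<i> t))\<^sup>2 = (34 + 6 * t ^ 3 + t ^ 6) / 36"
  unfolding f_fun_2_ii cmod_power2 by (simp add: power2_eq_square field_simps flip: power_add)

lemma cmod_f_fun_3_ii: "(cmod (f_fun 3 \<i> t))\<^sup>2 = (569 + 40 * t ^ 4 + t ^ 8) / 576"
  unfolding f_fun_3_ii cmod_power2 by (simp add: power2_eq_square field_simps flip: power_add)

lemma integral_f_fun_2_ii:
  "has_bochner_integral (uniform_measure lborel {0..1}) (\<lambda>t. (cmod (f_fun 2 \<i> t))\<^sup>2) (499 / 504)"
proof -
  have "has_bochner_integral (uniform_measure lborel {0..1}) (\<lambda>t. (34 + 6 * t ^ 3 + t ^ 6) / 36)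
      ((\<lambda>t. (34 * t + 3 / 2 * t ^ 4 + t ^ 7 / 7) / 36) 1 - (\<lambda>t. (34 * t + 3 / 2 * t ^ 4 + t ^ 7 / 7) / 36) (0::real))"
    by (rule has_bochner_integral_uniform_FTC) (auto intro!: derivative_eq_intros continuous_intros)
  then show ?thesis by (simp add: cmod_f_fun_2_ii)
qed

lemma integral_f_fun_3_ii:
  "has_bochner_integral (uniform_measure lborel {0..1}) (\<lambda>t. (cmod (f_fun 3 \<i> t))\<^sup>2) (577 / 576 + 1 / 5184)"
proof -
  have "has_bochner_integral (uniform_measure lborel {0..1}) (\<lambda>t. (569 + 40 * t ^ 4 + t ^ 8) / 576)
      ((\<lambda>t. (569 * t + 8 * t ^ 5 + t ^ 9 / 9) / 576) 1 - (\<lambda>t. (569 * t + 8 * t ^ 5 + t ^ 9 / 9) / 576) (0::real))"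
    by (rule has_bochner_integral_uniform_FTC) (auto intro!: derivative_eq_intros continuous_intros)
  then show ?thesis by (simp add: cmod_f_fun_3_ii)
qed

text \<open>An upper bound for the mean suffices, so the reciprocal is majorised by a polynomial,
  whose integral is about 0.9986.\<close>

lemma integral_inverse_f_fun_3_ii:
  obtains c where "has_bochner_integral (uniform_measure lborel {0..1}) (\<lambda>t. 1 / (cmod (f_fun 3 \<i> t))\<^sup>2) c"
    and "c < 1"
proof -
  let ?U = "uniform_measure lborel {0..1::real}"
  \<comment> \<open>from \<open>1 / (1 + x) \<le> 1 - x + x\<^sup>2\<close> with \<open>x = 40 t\<^sup>4 / 569\<close>\<close>
  define h :: "real \<Rightarrow> real" where "h t = 576 / 569 * (1 - 40 / 569 * t ^ 4 + (40 / 569)\<^sup>2 * t ^ 8)" for t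
  define H :: "real \<Rightarrow> real" where "H t = 576 / 569 * (t - 8 / 569 * t ^ 5 + (40 / 569)\<^sup>2 / 9 * t ^ 9)" for t
  have h: "has_bochner_integral ?U h (H 1 - H 0)"
    unfolding h_def[abs_def] H_def[abs_def]
    by (rule has_bochner_integral_uniform_FTC)
       (auto intro!: derivative_eq_intros continuous_intros simp: field_simps)
  have le: "1 / (cmod (f_fun 3 \<i> t))\<^sup>2 \<le> h t" for t
  proof -
    define x where "x = 40 / 569 * t ^ 4"
    have x: "x \<ge> 0" by (simp add: x_def)
    have "1 / (cmod (f_fun 3 \<i> t))\<^sup>2 = 576 / (569 * (1 + x) + t ^ 8)"
      by (simp add: cmod_f_fun_3_ii x_def)
    also have "\<dots> \<le> 576 / (569 * (1 + x))"
      using x by (intro divide_left_mono) (auto intro!: mult_pos_pos add_pos_nonneg)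
    also have "\<dots> = 576 / 569 * (1 / (1 + x))" by simp
    \<comment> \<open>The cruder bound \<open>1 / (1 + x) \<le> 1\<close> would only give 576/569,
      which exceeds 1.\<close>
    also have "\<dots> \<le> 576 / 569 * (1 - x + x\<^sup>2)"
    proof (rule mult_left_mono)
      have "(1 - x + x\<^sup>2) * (1 + x) = 1 + x ^ 3" by (simp add: algebra_simps power2_eq_square power3_eq_cube)
      then show "1 / (1 + x) \<le> 1 - x + x\<^sup>2" using x by (simp add: divide_le_eq)
    qed simp
    also have "\<dots> = h t" by (simp add: h_def x_def power2_eq_square flip: power_add)
    finally show ?thesis .
  qed
  have int: "integrable ?U (\<lambda>t. 1 / (cmod (f_fun 3 \<i> t))\<^sup>2)"
  proof (rule Bochner_Integration.integrable_bound)
    show "integrable ?U h" using h by (simp add: has_bochner_integral_iff)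
    show "AE t in ?U. norm (1 / (cmod (f_fun 3 \<i> t))\<^sup>2) \<le> norm (h t)"
      using le by (intro AE_I2) (auto intro: order_trans[OF _ abs_ge_self])
  qed measurable
  have "(\<integral>t. 1 / (cmod (f_fun 3 \<i> t))\<^sup>2 \<partial>?U) \<le> H 1 - H 0"
    using integral_mono[OF int _ le] h by (simp add: has_bochner_integral_iff)
  also have "\<dots> < 1" by (simp add: H_def power2_eq_square)
  finally show ?thesis
    using int that has_bochner_integral_integrable by blast
qed

section \<open>Almost sure behaviour at \<open>z = \<i>\<close>\<close>

lemma ii_in_R_AS_2:
  assumes "prob_space M" and "prob_space.indep_vars M (\<lambda>_. borel) \<tau> {1..}"
    and "\<And>l. l \<ge> 1 \<Longrightarrow> distr M borel (\<tau> l) = uniform_measure lborel {0..1}"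
  shows "\<i> \<in> R_AS M \<tau> \<eta> 2"
proof -
  interpret prob_space M by fact
  have "AE \<omega> in M. (\<lambda>k. \<Prod>l=1..k. (cmod (f_fun 2 \<i> (\<tau> l \<omega>)))\<^sup>2) \<longlonglongrightarrow> 0"
    by (rule AE_prod_iid_tendsto_0[OF assms(2,3) _ integral_f_fun_2_ii]) auto
  then have "AE \<omega> in M. (\<lambda>k. v_seq \<eta> \<tau> 2 \<i> k \<omega>) \<longlonglongrightarrow> 0"
  proof eventually_elim
    case (elim \<omega>)
    have "(\<lambda>k. (cmod (v_seq \<eta> \<tau> 2 \<i> k \<omega>))\<^sup>2) \<longlonglongrightarrow> 0"
      unfolding cmod_v_seq_power2 using tendsto_mult_right_zero[OF elim] by simp
    then show ?case
      using tendsto_real_sqrt[of "\<lambda>k. (cmod (v_seq \<eta> \<tau> 2 \<i> k \<omega>))\<^sup>2" 0 sequentially]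
      by (simp add: tendsto_norm_zero_iff)
  qed
  then show ?thesis by (simp add: R_AS_def)
qed

lemma ii_notin_R_AS_3:
  assumes "prob_space M" and "prob_space.indep_vars M (\<lambda>_. borel) \<tau> {1..}"
    and "\<And>l. l \<ge> 1 \<Longrightarrow> distr M borel (\<tau> l) = uniform_measure lborel {0..1}" and "\<eta> \<noteq> 0"
  shows "\<i> \<notin> R_AS M \<tau> \<eta> 3"
proof
  interpret prob_space M by fact
  obtain c where c: "has_bochner_integral (uniform_measure lborel {0..1}) (\<lambda>t. 1 / (cmod (f_fun 3 \<i> t))\<^sup>2) c" "c < 1"
    by (rule integral_inverse_f_fun_3_ii)
  \<comment> \<open>The real part is the constant 13/24. Nonvanishing lets the factors cancel
    against their reciprocals below.\<close>
  have f: "f_fun 3 \<i> t \<noteq> 0" for t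
    by (simp add: f_fun_3_ii complex_eq_iff)
  have "AE \<omega> in M. (\<lambda>k. \<Prod>l=1..k. 1 / (cmod (f_fun 3 \<i> (\<tau> l \<omega>)))\<^sup>2) \<longlonglongrightarrow> 0"
    by (rule AE_prod_iid_tendsto_0[OF assms(2,3) _ c(1) _ c(2)]) auto
  moreover assume "\<i> \<in> R_AS M \<tau> \<eta> 3"
  then have "AE \<omega> in M. (\<lambda>k. v_seq \<eta> \<tau> 3 \<i> k \<omega>) \<longlonglongrightarrow> 0"
    by (simp add: R_AS_def)
  ultimately have "AE \<omega> in M. False"
  proof eventually_elim
    case (elim \<omega>)
    \<comment> \<open>If both factors tended to 0, so would their product, which is the nonzero
      constant \<open>(cmod \<eta>)\<^sup>2\<close>.\<close>
    have "(cmod (v_seq \<eta> \<tau> 3 \<i> k \<omega>))\<^sup>2 * (\<Prod>l=1..k. 1 / (cmod (f_fun 3 \<i> (\<tau> l \<omega>)))\<^sup>2) = (cmod \<eta>)\<^sup>2" for k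
      unfolding cmod_v_seq_power2 using f by (simp add: prod_dividef)
    moreover have "(\<lambda>k. (cmod (v_seq \<eta> \<tau> 3 \<i> k \<omega>))\<^sup>2 * (\<Prod>l=1..k. 1 / (cmod (f_fun 3 \<i> (\<tau> l \<omega>)))\<^sup>2)) \<longlonglongrightarrow> (cmod 0)\<^sup>2 * 0"
      by (intro tendsto_intros elim)
    ultimately show ?case
      using \<open>\<eta> \<noteq> 0\<close> by (simp add: LIMSEQ_const_iff)
  qed
  then show False by simp
qed

text \<open>At \<open>t = 0\<close> the last term of \<open>f_fun (r + 1)\<close> vanishes and the
  Taylor polynomial of degree \<open>r + 2\<close> remains. For \<open>r = 2\<close> the modulus
  formula for \<open>f_fun 3\<close> can thus be reused, giving 569/576.\<close>

lemma R_ref_iff_f_fun: "z \<in> R_ref r \<longleftrightarrow> cmod (f_fun (r + 1) z 0) < 1"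
  by (simp add: R_ref_def f_fun_def)

lemma ii_in_R_ref_2: "\<i> \<in> R_ref 2"
proof -
  have "(cmod (f_fun 3 \<i> 0))\<^sup>2 < 1\<^sup>2"
    by (simp add: cmod_f_fun_3_ii)
  then show ?thesis
    unfolding R_ref_iff_f_fun by (simp add: power2_less_imp_less)
qed

text \<open>The squared modulus of the degree 5 Taylor polynomial at \<open>\<i>\<close> is
  14426/14400, just above 1.\<close>

lemma ii_notin_R_ref_3: "\<i> \<notin> R_ref 3"
proof -
  have "(\<Sum>j=0..3+2. \<i> ^ j / fact j) = Complex (13 / 24) (101 / 120)"
    by (simp add: complex_eq_iff numeral_eq_Suc fact_numeral field_simps)
  then have "(cmod (\<Sum>j=0..3+2. \<i> ^ j / fact j))\<^sup>2 = (13 / 24)\<^sup>2 + (101 / 120)\<^sup>2"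
    by (simp only: cmod_power2 complex.sel)
  also have "\<dots> > (1::real)"
    by (simp add: power2_eq_square)
  finally have "(cmod (\<Sum>j=0..3+2. \<i> ^ j / fact j))\<^sup>2 > 1" .
  then show ?thesis
    unfolding R_ref_def mem_Collect_eq by (smt (verit) norm_ge_zero power_le_one)
qed

theorem mainTheorem4:
  fixes M :: "'a measure" and \<tau> :: "nat \<Rightarrow> 'a \<Rightarrow> real" and \<eta> :: complex
  assumes "prob_space M"
    and "prob_space.indep_vars M (\<lambda>_. borel) \<tau> {1..}"
    and "\<And>l. l \<ge> 1 \<Longrightarrow> distr M borel (\<tau> l) = uniform_measure lborel {0..1}"
    and "\<eta> \<noteq> 0"
  shows "\<not> (\<forall>r. R_ref r \<subseteq> R_ref (r + 1)) \<and>
         \<not> (\<forall>r. R_MS M \<tau> \<eta> r \<subseteq> R_MS M \<tau> \<eta> (r + 1)) \<and>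
         \<not> (\<forall>r. R_AS M \<tau> \<eta> r \<subseteq> R_AS M \<tau> \<eta> (r + 1))"
proof -
  \<comment> \<open>The witness \<open>r = 2\<close> refutes all three inclusions.\<close>
  have succ: "2 + 1 = (3::nat)" by simp
  have "\<not> R_ref 2 \<subseteq> R_ref (2 + 1)"
    unfolding succ using ii_in_R_ref_2 ii_notin_R_ref_3 by blast
  moreover have "\<not> R_MS M \<tau> \<eta> 2 \<subseteq> R_MS M \<tau> \<eta> (2 + 1)"
    unfolding succ using R_MS_iff[OF assms integral_f_fun_2_ii] R_MS_iff[OF assms integral_f_fun_3_ii]
    by auto
  moreover have "\<not> R_AS M \<tau> \<eta> 2 \<subseteq> R_AS M \<tau> \<eta> (2 + 1)"
    unfolding succ using ii_in_R_AS_2[OF assms(1-3)] ii_notin_R_AS_3[OF assms] by blast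
  ultimately show ?thesis by blast
qed

end
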